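(* Suppose $K$ is an $\mathcal O$-operator on a Leibniz algebra $(\mathfrak g,[\ ,\ ])$ with respect to a representation $(V,\rho^L,\rho^R)$, and let $S\in\mathfrak{gl}(V)$ and $N\in\mathfrak{gl}(\mathfrak g)$. If $(K,S,N)$ is an $\mathcal O$N-structure or a dual $\mathcal O$N-structure on $(\mathfrak g,[\ ,\ ])$ associated to $(V,\rho^L,\rho^R)$, then $K$ and $KS$ are compatible $\mathcal O$-operators.
   Context: $k$ is a field of characteristic $0$; all vector spaces are finite dimensional over $k$. A (left) Leibniz algebra $(\mathfrak g,[\ ,\ ])$ is a vector space with a bilinear bracket satisfying $[x,[y,z]]=[[x,y],z]+[y,[x,z]]$. A representation $(V,\rho^L,\rho^R)$ of it is a vector space $V$ with linear maps $\rho^L,\rho^R:\mathfrak g\to\mathfrak{gl}(V)$ such that for all $x,y\in\mathfrak g$: $\rho^L([x,y])=[\rho^L(x),\rho^L(y)]$, $\rho^R([x,y])=[\rho^L(x),\rho^R(y)]$ (commutators), and $\rho^R(y)\rho^L(x)=-\rho^R(y)\rho^R(x)$. An $\mathcal O$-operator on $\mathfrak g$ with respect to $(V,\rho^L,\rho^R)$ is a linear map $K:V\to\mathfrak g$ with $[K(u),K(v)]=K(\rho^L(K(u))v+\rho^R(K(v))u)$. Put $[u,v]^K=\rho^L(K(u))v+\rho^R(K(v))u$. Two $\mathcal O$-operators $K_1,K_2$ with respect to the same representation are compatible if $n_1K_1+n_2K_2$ is an $\mathcal O$-operator for all $n_1,n_2\in k$. A Nijenhuis operator on $\mathfrak g$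 is a linear endomorphism $N$ with $[N(x),N(y)]=N([N(x),y]+[x,N(y)]-N[x,y])$. A pair $(N,S)$, $N\in\mathfrak{gl}(\mathfrak g)$, $S\in\mathfrak{gl}(V)$, is a Nijenhuis pair if $N$ is a Nijenhuis operator and for all $y\in\mathfrak g$, $w\in V$ and each $\rho\in\{\rho^L,\rho^R\}$: $\rho(N(y))S(w)=S(\rho(N(y))w)+S(\rho(y)S(w))-S^2(\rho(y)w)$. It is a dual-Nijenhuis pair if $N$ is a Nijenhuis operator and for all $y,w$ and each such $\rho$: $\rho(N(y))S(w)=S(\rho(N(y))w)+\rho(y)S^2(w)-S(\rho(y)S(w))$. The triple $(K,S,N)$ is an $\mathcal O$N-structure (resp. dual $\mathcal O$N-structure) if $K$ is an $\mathcal O$-operator, $(N,S)$ is a Nijenhuis pair (resp. dual-Nijenhuis pair), $NK=KS$, and $[w,u]^{NK}=[w,u]_S^K$ for all $w,u\in V$, where $[w,u]^{NK}=\rho^L(NK(w))u+\rho^R(NK(u))w$ and $[w,u]_S^K=[S(w),u]^K+[w,S(u)]^K-S[w,u]^K$. *)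

theory Defs
  imports Complex_Main
begin

locale fin_dim_space = vector_space scale
  for scale :: "'k::field \<Rightarrow> 'a::ab_group_add \<Rightarrow> 'a" +
  assumes finite_dim: "\<exists>B. finite B \<and> span B = UNIV"

definition bilinear_map ::
  "('k::field \<Rightarrow> 'a::ab_group_add \<Rightarrow> 'a) \<Rightarrow> ('k \<Rightarrow> 'b::ab_group_add \<Rightarrow> 'b) \<Rightarrow>
   ('k \<Rightarrow> 'c::ab_group_add \<Rightarrow> 'c) \<Rightarrow> ('a \<Rightarrow> 'b \<Rightarrow> 'c) \<Rightarrow> bool"
  where "bilinear_map sA sB sC f \<longleftrightarrow>
    (\<forall>x. Vector_Spaces.linear sB sC (f x)) \<and>
    (\<forall>y. Vector_Spaces.linear sA sC (\<lambda>x. f x y))"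

locale leibniz_algebra = fin_dim_space sG
  for sG :: "'k::field_char_0 \<Rightarrow> 'g::ab_group_add \<Rightarrow> 'g"
    and br :: "'g \<Rightarrow> 'g \<Rightarrow> 'g" +
  assumes bracket_bilinear: "bilinear_map sG sG sG br"
    and left_leibniz: "br x (br y z) = br (br x y) z + br y (br x z)"

text \<open>A linear map from the algebra to the endomorphisms of the space is given in uncurried
  form, as a bilinear map.\<close>

locale leibniz_representation = leibniz_algebra sG br + V: fin_dim_space sV
  for sG :: "'k::field_char_0 \<Rightarrow> 'g::ab_group_add \<Rightarrow> 'g"
    and br :: "'g \<Rightarrow> 'g \<Rightarrow> 'g"
    and sV :: "'k \<Rightarrow> 'v::ab_group_add \<Rightarrow> 'v"
    and rhoL rhoR :: "'g \<Rightarrow> 'v \<Rightarrow> 'v" +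
  assumes rhoL_bilinear: "bilinear_map sG sV sV rhoL"
    and rhoR_bilinear: "bilinear_map sG sV sV rhoR"
    and rhoL_bracket: "rhoL (br x y) v = rhoL x (rhoL y v) - rhoL y (rhoL x v)"
    and rhoR_bracket: "rhoR (br x y) v = rhoL x (rhoR y v) - rhoR y (rhoL x v)"
    and rhoR_rhoL: "rhoR y (rhoL x v) = - rhoR y (rhoR x v)"

text \<open>The bracket \<open>[u,v]\<^sup>K\<close>; \<open>K\<close> need not be an O-operator.\<close>

definition op_bracket ::
  "('g \<Rightarrow> 'v \<Rightarrow> 'v::ab_group_add) \<Rightarrow> ('g \<Rightarrow> 'v \<Rightarrow> 'v) \<Rightarrow> ('v \<Rightarrow> 'g) \<Rightarrow> 'v \<Rightarrow> 'v \<Rightarrow> 'v"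
  where "op_bracket rhoL rhoR K u v = rhoL (K u) v + rhoR (K v) u"

text \<open>The deformation \<open>[w,u]\<^sub>S\<close> of a bracket \<open>b\<close> by an endomorphism \<open>S\<close>.\<close>

definition deformed_bracket ::
  "('v \<Rightarrow> 'v \<Rightarrow> 'v::ab_group_add) \<Rightarrow> ('v \<Rightarrow> 'v) \<Rightarrow> 'v \<Rightarrow> 'v \<Rightarrow> 'v"
  where "deformed_bracket b S w u = b (S w) u + b w (S u) - S (b w u)"

definition O_operator ::
  "('k::field \<Rightarrow> 'g::ab_group_add \<Rightarrow> 'g) \<Rightarrow> ('g \<Rightarrow> 'g \<Rightarrow> 'g) \<Rightarrow>
   ('k \<Rightarrow> 'v::ab_group_add \<Rightarrow> 'v) \<Rightarrow> ('g \<Rightarrow> 'v \<Rightarrow> 'v) \<Rightarrow> ('g \<Rightarrow> 'v \<Rightarrow> 'v) \<Rightarrow>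
   ('v \<Rightarrow> 'g) \<Rightarrow> bool"
  where "O_operator sG br sV rhoL rhoR K \<longleftrightarrow>
    Vector_Spaces.linear sV sG K \<and>
    (\<forall>u v. br (K u) (K v) = K (rhoL (K u) v + rhoR (K v) u))"

definition compatible_O_operators ::
  "('k::field \<Rightarrow> 'g::ab_group_add \<Rightarrow> 'g) \<Rightarrow> ('g \<Rightarrow> 'g \<Rightarrow> 'g) \<Rightarrow>
   ('k \<Rightarrow> 'v::ab_group_add \<Rightarrow> 'v) \<Rightarrow> ('g \<Rightarrow> 'v \<Rightarrow> 'v) \<Rightarrow> ('g \<Rightarrow> 'v \<Rightarrow> 'v) \<Rightarrow>
   ('v \<Rightarrow> 'g) \<Rightarrow> ('v \<Rightarrow> 'g) \<Rightarrow> bool"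
  where "compatible_O_operators sG br sV rhoL rhoR K1 K2 \<longleftrightarrow>
    O_operator sG br sV rhoL rhoR K1 \<and> O_operator sG br sV rhoL rhoR K2 \<and>
    (\<forall>n1 n2. O_operator sG br sV rhoL rhoR (\<lambda>v. sG n1 (K1 v) + sG n2 (K2 v)))"

definition nijenhuis_operator ::
  "('k::field \<Rightarrow> 'g::ab_group_add \<Rightarrow> 'g) \<Rightarrow> ('g \<Rightarrow> 'g \<Rightarrow> 'g) \<Rightarrow> ('g \<Rightarrow> 'g) \<Rightarrow> bool"
  where "nijenhuis_operator sG br N \<longleftrightarrow>
    Vector_Spaces.linear sG sG N \<and>
    (\<forall>x y. br (N x) (N y) = N (br (N x) y + br x (N y) - N (br x y)))"

definition nijenhuis_pair ::
  "('k::field \<Rightarrow> 'g::ab_group_add \<Rightarrow> 'g) \<Rightarrow> ('g \<Rightarrow> 'g \<Rightarrow> 'g) \<Rightarrow>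
   ('k \<Rightarrow> 'v::ab_group_add \<Rightarrow> 'v) \<Rightarrow> ('g \<Rightarrow> 'v \<Rightarrow> 'v) \<Rightarrow> ('g \<Rightarrow> 'v \<Rightarrow> 'v) \<Rightarrow>
   ('g \<Rightarrow> 'g) \<Rightarrow> ('v \<Rightarrow> 'v) \<Rightarrow> bool"
  where "nijenhuis_pair sG br sV rhoL rhoR N S \<longleftrightarrow>
    nijenhuis_operator sG br N \<and> Vector_Spaces.linear sV sV S \<and>
    (\<forall>rho \<in> {rhoL, rhoR}. \<forall>y w.
      rho (N y) (S w) = S (rho (N y) w) + S (rho y (S w)) - S (S (rho y w)))"

definition dual_nijenhuis_pair ::
  "('k::field \<Rightarrow> 'g::ab_group_add \<Rightarrow> 'g) \<Rightarrow> ('g \<Rightarrow> 'g \<Rightarrow> 'g) \<Rightarrow>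
   ('k \<Rightarrow> 'v::ab_group_add \<Rightarrow> 'v) \<Rightarrow> ('g \<Rightarrow> 'v \<Rightarrow> 'v) \<Rightarrow> ('g \<Rightarrow> 'v \<Rightarrow> 'v) \<Rightarrow>
   ('g \<Rightarrow> 'g) \<Rightarrow> ('v \<Rightarrow> 'v) \<Rightarrow> bool"
  where "dual_nijenhuis_pair sG br sV rhoL rhoR N S \<longleftrightarrow>
    nijenhuis_operator sG br N \<and> Vector_Spaces.linear sV sV S \<and>
    (\<forall>rho \<in> {rhoL, rhoR}. \<forall>y w.
      rho (N y) (S w) = S (rho (N y) w) + rho y (S (S w)) - S (rho y (S w)))"

definition ON_structure ::
  "('k::field \<Rightarrow> 'g::ab_group_add \<Rightarrow> 'g) \<Rightarrow> ('g \<Rightarrow> 'g \<Rightarrow> 'g) \<Rightarrow>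
   ('k \<Rightarrow> 'v::ab_group_add \<Rightarrow> 'v) \<Rightarrow> ('g \<Rightarrow> 'v \<Rightarrow> 'v) \<Rightarrow> ('g \<Rightarrow> 'v \<Rightarrow> 'v) \<Rightarrow>
   ('v \<Rightarrow> 'g) \<Rightarrow> ('v \<Rightarrow> 'v) \<Rightarrow> ('g \<Rightarrow> 'g) \<Rightarrow> bool"
  where "ON_structure sG br sV rhoL rhoR K S N \<longleftrightarrow>
    O_operator sG br sV rhoL rhoR K \<and>
    nijenhuis_pair sG br sV rhoL rhoR N S \<and>
    N \<circ> K = K \<circ> S \<and>
    (\<forall>w u. op_bracket rhoL rhoR (N \<circ> K) w u = deformed_bracket (op_bracket rhoL rhoR K) S w u)"

definition dual_ON_structure ::
  "('k::field \<Rightarrow> 'g::ab_group_add \<Rightarrow> 'g) \<Rightarrow> ('g \<Rightarrow> 'g \<Rightarrow> 'g) \<Rightarrow>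
   ('k \<Rightarrow> 'v::ab_group_add \<Rightarrow> 'v) \<Rightarrow> ('g \<Rightarrow> 'v \<Rightarrow> 'v) \<Rightarrow> ('g \<Rightarrow> 'v \<Rightarrow> 'v) \<Rightarrow>
   ('v \<Rightarrow> 'g) \<Rightarrow> ('v \<Rightarrow> 'v) \<Rightarrow> ('g \<Rightarrow> 'g) \<Rightarrow> bool"
  where "dual_ON_structure sG br sV rhoL rhoR K S N \<longleftrightarrow>
    O_operator sG br sV rhoL rhoR K \<and>
    dual_nijenhuis_pair sG br sV rhoL rhoR N S \<and>
    N \<circ> K = K \<circ> S \<and>
    (\<forall>w u. op_bracket rhoL rhoR (N \<circ> K) w u = deformed_bracket (op_bracket rhoL rhoR K) S w u)"

end

theory Submission imports Defs begin

text \<open>Write \<open>T = K S = N K\<close>. Being an O-operator is a quadratic condition, so the combination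
  \<open>n1 K + n2 T\<close> satisfies it for all coefficients as soon as \<open>K\<close> and \<open>T\<close> do and the mixed terms
  agree:
  \<open>[K u, T v] + [T u, K v] = K [u,v]\<^sup>T + T [u,v]\<^sup>K\<close>.

  The mixed relation comes from moving \<open>S\<close> inside \<open>K\<close>: since \<open>K\<close> is an O-operator, the left-hand
  side is \<open>K ([u, S v]\<^sup>K + [S u, v]\<^sup>K)\<close>, and the identity \<open>[u,v]\<^sup>T = [u,v]\<^sub>S\<^sup>K\<close> rewrites the argument
  of \<open>K\<close> as \<open>[u,v]\<^sup>T + S [u,v]\<^sup>K\<close> (\<open>O_operator_mixed_relation\<close>).

  That \<open>T\<close> is an O-operator then follows from the other factorisation \<open>T = N K\<close>. The Nijenhuis
  identity at \<open>K u\<close>, \<open>K v\<close> reads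
  \<open>[T u, T v] = N ([T u, K v] + [K u, T v] - N [K u, K v])\<close>; by the mixed relation the first two
  terms are \<open>K [u,v]\<^sup>T + T [u,v]\<^sup>K\<close>, and the last one is \<open>N K [u,v]\<^sup>K = T [u,v]\<^sup>K\<close>, so that
  \<open>N K [u,v]\<^sup>T\<close> remains (\<open>O_operator_nijenhuis_comp\<close>).\<close>

lemma bilinear_mapD:
  assumes "bilinear_map sA sB sC f"
  shows "f (x + x') y = f x y + f x' y" "f (sA c x) y = sC c (f x y)"
    and "f x (y + y') = f x y + f x y'" "f x (sB c y) = sC c (f x y)"
proof -
  interpret l: Vector_Spaces.linear sA sC "\<lambda>x. f x y"
    using assms by (simp add: bilinear_map_def)
  interpret r: Vector_Spaces.linear sB sC "f x"
    using assms by (simp add: bilinear_map_def)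
  show "f (x + x') y = f x y + f x' y" "f (sA c x) y = sC c (f x y)"
    "f x (y + y') = f x y + f x y'" "f x (sB c y) = sC c (f x y)"
    by (fact l.add l.scale r.add r.scale)+
qed

lemma O_operatorD:
  assumes "O_operator sG br sV rhoL rhoR K"
  shows "Vector_Spaces.linear sV sG K"
    and "br (K u) (K v) = K (op_bracket rhoL rhoR K u v)"
  using assms by (simp_all add: O_operator_def op_bracket_def)

context leibniz_representation
begin

lemma op_bracket_lincomb:
  "op_bracket rhoL rhoR (\<lambda>v. sG a (K1 v) + sG b (K2 v)) u v
    = sV a (op_bracket rhoL rhoR K1 u v) + sV b (op_bracket rhoL rhoR K2 u v)"
  by (simp add: op_bracket_def bilinear_mapD[OF rhoL_bilinear] bilinear_mapD[OF rhoR_bilinear]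
      V.scale_right_distrib algebra_simps)

text \<open>Polarisation: in the O-operator condition for \<open>n1 K1 + n2 K2\<close> the coefficients of \<open>n1\<^sup>2\<close> and
  \<open>n2\<^sup>2\<close> are the conditions for \<open>K1\<close> and \<open>K2\<close>, and the coefficient of \<open>n1 n2\<close> is the mixed
  relation.\<close>

lemma compatible_if_mixed_relation:
  assumes K1: "O_operator sG br sV rhoL rhoR K1" and K2: "O_operator sG br sV rhoL rhoR K2"
    and mixed: "\<And>u v. br (K1 u) (K2 v) + br (K2 u) (K1 v)
      = K1 (op_bracket rhoL rhoR K2 u v) + K2 (op_bracket rhoL rhoR K1 u v)"
  shows "compatible_O_operators sG br sV rhoL rhoR K1 K2"
  unfolding compatible_O_operators_def
proof (intro conjI allI K1 K2)
  fix a b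
  interpret VG: vector_space_pair sV sG ..
  interpret K1: Vector_Spaces.linear sV sG K1 by (rule O_operatorD[OF K1])
  interpret K2: Vector_Spaces.linear sV sG K2 by (rule O_operatorD[OF K2])
  let ?K = "\<lambda>v. sG a (K1 v) + sG b (K2 v)"
  have lin: "Vector_Spaces.linear sV sG ?K"
    by (intro VG.linear_compose_add VG.linear_compose_scale_right
        K1.linear_axioms K2.linear_axioms)
  have "br (?K u) (?K v) = ?K (op_bracket rhoL rhoR ?K u v)" for u v
  proof -
    let ?B1 = "op_bracket rhoL rhoR K1 u v" and ?B2 = "op_bracket rhoL rhoR K2 u v"
    have "br (?K u) (?K v) = sG (a * a) (br (K1 u) (K1 v)) + sG (b * b) (br (K2 u) (K2 v))
        + sG (a * b) (br (K1 u) (K2 v) + br (K2 u) (K1 v))"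
      by (simp add: bilinear_mapD[OF bracket_bilinear] scale_right_distrib algebra_simps)
    also have "\<dots> = sG (a * a) (K1 ?B1) + sG (b * b) (K2 ?B2) + sG (a * b) (K1 ?B2 + K2 ?B1)"
      by (simp only: mixed O_operatorD(2)[OF K1] O_operatorD(2)[OF K2])
    also have "\<dots> = ?K (op_bracket rhoL rhoR ?K u v)"
      by (simp add: op_bracket_lincomb K1.add K2.add K1.scale K2.scale scale_right_distrib
          algebra_simps)
    finally show ?thesis .
  qed
  then show "O_operator sG br sV rhoL rhoR ?K"
    using lin by (simp add: O_operator_def op_bracket_def)
qed

text \<open>The deformed bracket of \<open>K\<close> along \<open>S\<close> is exactly the correction that arises when each
  summand on the left is contracted by the O-operator condition for \<open>K\<close>.\<close>

lemma O_operator_mixed_relation: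
  assumes K: "O_operator sG br sV rhoL rhoR K"
    and deformed: "op_bracket rhoL rhoR (K \<circ> S) u v
      = deformed_bracket (op_bracket rhoL rhoR K) S u v"
  shows "br (K u) (K (S v)) + br (K (S u)) (K v)
    = K (op_bracket rhoL rhoR (K \<circ> S) u v) + K (S (op_bracket rhoL rhoR K u v))"
proof -
  interpret K: Vector_Spaces.linear sV sG K by (rule O_operatorD[OF K])
  show ?thesis
    by (simp add: O_operatorD(2)[OF K] deformed deformed_bracket_def K.add K.diff)
qed

text \<open>Evaluated on the image of \<open>K\<close>, the argument of \<open>N\<close> on the right of the Nijenhuis identity is
  the left-hand side of the mixed relation minus \<open>N [K u, K v]\<close>, and the latter cancels the second
  term of the mixed relation.\<close>

lemma O_operator_nijenhuis_comp:
  assumes K: "O_operator sG br sV rhoL rhoR K"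
    and N: "nijenhuis_operator sG br N"
    and mixed: "\<And>u v. br (K u) (N (K v)) + br (N (K u)) (K v)
      = K (op_bracket rhoL rhoR (N \<circ> K) u v) + N (K (op_bracket rhoL rhoR K u v))"
  shows "O_operator sG br sV rhoL rhoR (N \<circ> K)"
proof -
  have "Vector_Spaces.linear sV sG (N \<circ> K)"
    using O_operatorD(1)[OF K] N
    by (auto simp: nijenhuis_operator_def intro: Vector_Spaces.linear_compose)
  moreover have "br (N (K u)) (N (K v)) = N (K (op_bracket rhoL rhoR (N \<circ> K) u v))" for u v
  proof -
    have "br (N (K u)) (N (K v)) = N (br (N (K u)) (K v) + br (K u) (N (K v)) - N (br (K u) (K v)))"
      using N by (simp add: nijenhuis_operator_def)
    also have "br (N (K u)) (K v) + br (K u) (N (K v)) - N (br (K u) (K v))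
        = K (op_bracket rhoL rhoR (N \<circ> K) u v)"
      using mixed[of u v] by (simp add: O_operatorD(2)[OF K] algebra_simps)
    finally show ?thesis .
  qed
  ultimately show ?thesis
    by (simp add: O_operator_def op_bracket_def)
qed

end

theorem proposition4p7:
  fixes sG :: "'k::field_char_0 \<Rightarrow> 'g::ab_group_add \<Rightarrow> 'g"
    and br :: "'g \<Rightarrow> 'g \<Rightarrow> 'g"
    and sV :: "'k \<Rightarrow> 'v::ab_group_add \<Rightarrow> 'v"
    and rhoL rhoR :: "'g \<Rightarrow> 'v \<Rightarrow> 'v"
    and K :: "'v \<Rightarrow> 'g" and S :: "'v \<Rightarrow> 'v" and N :: "'g \<Rightarrow> 'g"
  assumes "leibniz_representation sG br sV rhoL rhoR"
    and "O_operator sG br sV rhoL rhoR K"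
    and "Vector_Spaces.linear sV sV S"
    and "Vector_Spaces.linear sG sG N"
    and "ON_structure sG br sV rhoL rhoR K S N \<or> dual_ON_structure sG br sV rhoL rhoR K S N"
  shows "compatible_O_operators sG br sV rhoL rhoR K (K \<circ> S)"
proof -
  interpret leibniz_representation sG br sV rhoL rhoR by (fact assms(1))
  have N: "nijenhuis_operator sG br N" and NK: "N \<circ> K = K \<circ> S"
    and deformed: "\<And>u v. op_bracket rhoL rhoR (N \<circ> K) u v
      = deformed_bracket (op_bracket rhoL rhoR K) S u v"
    using assms(5) by (auto simp: ON_structure_def dual_ON_structure_def
        nijenhuis_pair_def dual_nijenhuis_pair_def)
  have NK_apply: "N (K v) = K (S v)" for v
    using NK by (metis comp_apply)
  have mixed: "br (K u) (K (S v)) + br (K (S u)) (K v)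
      = K (op_bracket rhoL rhoR (K \<circ> S) u v) + K (S (op_bracket rhoL rhoR K u v))" for u v
    using O_operator_mixed_relation[OF assms(2)] deformed by (simp add: NK)
  have "O_operator sG br sV rhoL rhoR (N \<circ> K)"
    using mixed by (intro O_operator_nijenhuis_comp assms(2) N) (simp add: NK NK_apply)
  then have "O_operator sG br sV rhoL rhoR (K \<circ> S)"
    by (simp add: NK)
  then show ?thesis
    using mixed by (intro compatible_if_mixed_relation assms(2)) simp_all
qed

end
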